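(* Let $S$ be a symmetry group in dimension $d$, $G$ a graph, $\Phi:S\to\mathrm{Aut}(G)$ a map, and $(G,p)$ a framework in $\mathscr{R}_{(G,S,\Phi)}$. (i) If $\Phi$ is a homomorphism, then $\Phi(S)$ is a subgroup of $\mathrm{Aut}(G)$. (ii) If $\Phi(S)$ is a subgroup of $\mathrm{Aut}(G)$ and, for $x,y\in S$, $\Phi(x)=\Phi(y)$ whenever $\Phi(y)\in\Phi(x)\mathrm{Aut}(G,p)$, then $\Phi$ is a homomorphism.
   Context: Graphs are finite, simple, with nonempty vertex set. $\mathrm{Aut}(G)$ is the group (under composition) of automorphisms of $G$. A framework in $\mathbb{R}^d$ (also called a $d$-dimensional realization of $G$) is a pair $(G,p)$ with $G$ a graph and $p:V(G)\to\mathbb{R}^d$ a map with $p(u)\neq p(v)$ whenever $\{u,v\}\in E(G)$; $p$ need not be injective. A symmetry operation of $(G,p)$ is an isometry $x$ of $\mathbb{R}^d$ such that for some $\alpha\in\mathrm{Aut}(G)$, $x(p(v))=p(\alpha(v))$ for all $v\in V(G)$. The point group of $(G,p)$ is the group of all its symmetry operations. A symmetry group in dimension $d$ is a subgroup of the orthogonal group $O(\mathbb{R}^d)$. $\mathscr{R}_{(G,S)}$ is the set of all $d$-dimensional realizations of $G$ whose point group equals $S$ or contains $S$ as a subgroup. For a map $\Phi:S\to\mathrm{Aut}(G)$ (not necessarily a homomorphism), $\mathscr{R}_{(G,S,\Phi)}$ is the set of all $(G,p)\in\mathscr{R}_{(G,S)}$ with $x(p(v))=p(\Phi(x)(v))$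 for all $v\in V(G)$ and all $x\in S$. $\mathrm{Aut}(G,p)$ denotes the set (a subgroup of $\mathrm{Aut}(G)$) of all $\alpha\in\mathrm{Aut}(G)$ with $p(v)=p(\alpha(v))$ for all $v\in V(G)$; $\Phi(x)\mathrm{Aut}(G,p)$ is the left coset $\{\Phi(x)\circ\beta:\beta\in\mathrm{Aut}(G,p)\}$. *)

theory Defs
  imports "HOL-Analysis.Analysis" "HOL-Algebra.Coset" "HOL-Algebra.Bij"
    "Graph_Theory.Pair_Digraph"
begin

text \<open>
  An undirected edge \<open>{u, v}\<close> is represented by the two arcs \<open>(u, v)\<close> and \<open>(v, u)\<close>;
  the locale \<open>pair_graph\<close> makes the arc relation finite, symmetric and irreflexive.
\<close>

definition simple_graph :: "'v pair_pre_digraph \<Rightarrow> bool" where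
  "simple_graph G \<longleftrightarrow> pair_graph G \<and> pverts G \<noteq> {}"

text \<open>
  As in \<open>HOL-Algebra.Bij\<close>, permutations of the vertex set are extensional functions, so that
  equality of automorphisms means equality on the vertices.
\<close>

definition graph_auts :: "'v pair_pre_digraph \<Rightarrow> ('v \<Rightarrow> 'v) set" where
  "graph_auts G = {\<alpha> \<in> Bij (pverts G).
     \<forall>u \<in> pverts G. \<forall>v \<in> pverts G. (u, v) \<in> parcs G \<longleftrightarrow> (\<alpha> u, \<alpha> v) \<in> parcs G}"

definition graph_Aut :: "'v pair_pre_digraph \<Rightarrow> ('v \<Rightarrow> 'v) monoid" where
  "graph_Aut G = BijGroup (pverts G) \<lparr>carrier := graph_auts G\<rparr>"

lemma subgroup_graph_auts: "subgroup (graph_auts G) (BijGroup (pverts G))"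
proof (rule subgroup.intro)
  show "graph_auts G \<subseteq> carrier (BijGroup (pverts G))"
    by (auto simp: graph_auts_def BijGroup_def)
next
  fix x y assume x: "x \<in> graph_auts G" and y: "y \<in> graph_auts G"
  then have b: "x \<in> Bij (pverts G)" "y \<in> Bij (pverts G)" by (simp_all add: graph_auts_def)
  have "((u, v) \<in> parcs G) = ((x (y u), x (y v)) \<in> parcs G)"
    if "u \<in> pverts G" "v \<in> pverts G" for u v
  proof -
    have "y u \<in> pverts G" "y v \<in> pverts G"
      using that b(2) by (auto dest: Bij_imp_funcset)
    then show ?thesis using that x y by (auto simp: graph_auts_def)
  qed
  then show "x \<otimes>\<^bsub>BijGroup (pverts G)\<^esub> y \<in> graph_auts G"
    using b by (simp add: graph_auts_def BijGroup_def compose_Bij compose_eq)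
next
  show "\<one>\<^bsub>BijGroup (pverts G)\<^esub> \<in> graph_auts G"
    by (simp add: graph_auts_def BijGroup_def id_Bij)
next
  fix x assume x: "x \<in> graph_auts G"
  then have b: "x \<in> Bij (pverts G)" by (simp add: graph_auts_def)
  have "x (inv_into (pverts G) x u) = u" if "u \<in> pverts G" for u
    using b that by (auto simp: Bij_def bij_betw_def f_inv_into_f)
  then show "inv\<^bsub>BijGroup (pverts G)\<^esub> x \<in> graph_auts G"
    using x b by (auto simp: graph_auts_def inv_BijGroup restrict_inv_into_Bij Bij_inv_into_mem)
qed

lemma group_graph_Aut: "group (graph_Aut G)"
  unfolding graph_Aut_def
  by (rule subgroup.subgroup_is_group[OF subgroup_graph_auts group_BijGroup])

text \<open>Only the values of \<open>p\<close> on the vertices of \<open>G\<close> are relevant.\<close>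

definition framework :: "'v pair_pre_digraph \<Rightarrow> ('v \<Rightarrow> real ^ 'n) \<Rightarrow> bool" where
  "framework G p \<longleftrightarrow> simple_graph G \<and> (\<forall>(u, v) \<in> parcs G. p u \<noteq> p v)"

definition isometry :: "(real ^ 'n \<Rightarrow> real ^ 'n) \<Rightarrow> bool" where
  "isometry x \<longleftrightarrow> (\<forall>a b. dist (x a) (x b) = dist a b)"

definition symmetry_operation ::
    "'v pair_pre_digraph \<Rightarrow> ('v \<Rightarrow> real ^ 'n) \<Rightarrow> (real ^ 'n \<Rightarrow> real ^ 'n) \<Rightarrow> bool" where
  "symmetry_operation G p x \<longleftrightarrow>
     isometry x \<and> (\<exists>\<alpha> \<in> carrier (graph_Aut G). \<forall>v \<in> pverts G. x (p v) = p (\<alpha> v))"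

definition point_group ::
    "'v pair_pre_digraph \<Rightarrow> ('v \<Rightarrow> real ^ 'n) \<Rightarrow> (real ^ 'n \<Rightarrow> real ^ 'n) monoid" where
  "point_group G p = \<lparr>carrier = {x. symmetry_operation G p x}, mult = (\<circ>), one = id\<rparr>"

definition orthogonal_group :: "(real ^ 'n \<Rightarrow> real ^ 'n) monoid" where
  "orthogonal_group = \<lparr>carrier = {x. orthogonal_transformation x}, mult = (\<circ>), one = id\<rparr>"

definition symmetry_group :: "(real ^ 'n \<Rightarrow> real ^ 'n) set \<Rightarrow> bool" where
  "symmetry_group S \<longleftrightarrow> subgroup S orthogonal_group"

text \<open>For fixed \<open>G\<close>, a realization \<open>(G, p)\<close> is identified with its map \<open>p\<close>.\<close>

definition realizations ::
    "'v pair_pre_digraph \<Rightarrow> (real ^ 'n \<Rightarrow> real ^ 'n) set \<Rightarrow> ('v \<Rightarrow> real ^ 'n) set" where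
  "realizations G S = {p. framework G p \<and>
     (carrier (point_group G p) = S \<or> subgroup S (point_group G p))}"

definition realizations_of_type ::
    "'v pair_pre_digraph \<Rightarrow> (real ^ 'n \<Rightarrow> real ^ 'n) set \<Rightarrow>
     ((real ^ 'n \<Rightarrow> real ^ 'n) \<Rightarrow> 'v \<Rightarrow> 'v) \<Rightarrow> ('v \<Rightarrow> real ^ 'n) set" where
  "realizations_of_type G S \<Phi> =
     {p \<in> realizations G S. \<forall>x \<in> S. \<forall>v \<in> pverts G. x (p v) = p (\<Phi> x v)}"

definition framework_auts :: "'v pair_pre_digraph \<Rightarrow> ('v \<Rightarrow> real ^ 'n) \<Rightarrow> ('v \<Rightarrow> 'v) set" where
  "framework_auts G p = {\<alpha> \<in> carrier (graph_Aut G). \<forall>v \<in> pverts G. p v = p (\<alpha> v)}"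

lemma isometry_bij:
  assumes "isometry x"
  shows "bij x"
proof -
  let ?f = "\<lambda>a. x a - x 0"
  have "orthogonal_transformation ?f"
    using assms by (simp add: orthogonal_transformation_isometry isometry_def dist_norm)
  then have s: "surj ?f" by (rule orthogonal_transformation_surj)
  have "\<exists>a. b = x a" for b
    using surjD[OF s, of "b - x 0"] by auto
  then have "surj x" by (auto simp: surj_def)
  moreover have "inj x"
    using assms by (auto simp: isometry_def inj_def) (metis dist_eq_0_iff)
  ultimately show ?thesis by (simp add: bij_def)
qed

lemma group_point_group: "group (point_group G p)"
proof (rule groupI)
  fix x y assume xy: "x \<in> carrier (point_group G p)" "y \<in> carrier (point_group G p)"
  then obtain \<alpha> \<beta> where a: "\<alpha> \<in> graph_auts G" "\<forall>v \<in> pverts G. x (p v) = p (\<alpha> v)"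
    and b: "\<beta> \<in> graph_auts G" "\<forall>v \<in> pverts G. y (p v) = p (\<beta> v)"
    by (auto simp: point_group_def symmetry_operation_def graph_Aut_def)
  have "compose (pverts G) \<alpha> \<beta> \<in> graph_auts G"
    using subgroup.m_closed[OF subgroup_graph_auts a(1) b(1)] a(1) b(1)
    by (simp add: BijGroup_def graph_auts_def)
  moreover have "\<forall>v \<in> pverts G. x (y (p v)) = p (compose (pverts G) \<alpha> \<beta> v)"
    using a b by (auto simp: compose_eq graph_auts_def dest: Bij_imp_funcset[THEN funcset_mem])
  moreover have "isometry (x \<circ> y)"
    using xy by (simp add: point_group_def symmetry_operation_def isometry_def)
  ultimately show "x \<otimes>\<^bsub>point_group G p\<^esub> y \<in> carrier (point_group G p)"
    by (auto simp: point_group_def symmetry_operation_def graph_Aut_def)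
next
  have "(\<lambda>v \<in> pverts G. v) \<in> graph_auts G"
    using subgroup.one_closed[OF subgroup_graph_auts] by (simp add: BijGroup_def)
  then show "\<one>\<^bsub>point_group G p\<^esub> \<in> carrier (point_group G p)"
    by (auto simp: point_group_def symmetry_operation_def graph_Aut_def isometry_def
        intro!: bexI[of _ "\<lambda>v \<in> pverts G. v"])
next
  fix x assume x: "x \<in> carrier (point_group G p)"
  then obtain \<alpha> where iso: "isometry x"
    and a: "\<alpha> \<in> graph_auts G" "\<forall>v \<in> pverts G. x (p v) = p (\<alpha> v)"
    by (auto simp: point_group_def symmetry_operation_def graph_Aut_def)
  have b: "bij x" using iso by (rule isometry_bij)
  let ?\<beta> = "\<lambda>v \<in> pverts G. inv_into (pverts G) \<alpha> v"
  have ab: "\<alpha> \<in> Bij (pverts G)" using a(1) by (simp add: graph_auts_def)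
  have "?\<beta> \<in> graph_auts G"
    using subgroup.m_inv_closed[OF subgroup_graph_auts a(1)] ab by (simp add: inv_BijGroup)
  moreover have "inv_into UNIV x (p v) = p (?\<beta> v)" if v: "v \<in> pverts G" for v
  proof -
    have "\<alpha> (?\<beta> v) = v" using ab v by (auto simp: Bij_def bij_betw_def f_inv_into_f)
    moreover have "?\<beta> v \<in> pverts G" using ab v by (simp add: Bij_inv_into_mem)
    ultimately have "x (p (?\<beta> v)) = p v" using a(2) by simp
    then show ?thesis using b by (metis bij_inv_eq_iff)
  qed
  moreover have "isometry (inv_into UNIV x)"
    using iso b unfolding isometry_def by (metis bij_inv_eq_iff)
  ultimately have "inv_into UNIV x \<in> carrier (point_group G p)"
    by (auto simp: point_group_def symmetry_operation_def graph_Aut_def intro!: bexI[of _ ?\<beta>])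
  moreover have "inv_into UNIV x \<circ> x = id" using b by (simp add: bij_is_inj)
  ultimately show "\<exists>y \<in> carrier (point_group G p). y \<otimes>\<^bsub>point_group G p\<^esub> x = \<one>\<^bsub>point_group G p\<^esub>"
    by (auto simp: point_group_def)
qed (auto simp: point_group_def fun_eq_iff)

lemma group_orthogonal_group: "group orthogonal_group"
proof (rule groupI)
  fix x :: "real ^ 'n \<Rightarrow> real ^ 'n" assume "x \<in> carrier orthogonal_group"
  then have o: "orthogonal_transformation x" by (simp add: orthogonal_group_def)
  have "inv_into UNIV x \<circ> x = id" using o by (simp add: orthogonal_transformation_inj)
  with orthogonal_transformation_inv[OF o]
  show "\<exists>y \<in> carrier orthogonal_group. y \<otimes>\<^bsub>orthogonal_group\<^esub> x = \<one>\<^bsub>orthogonal_group\<^esub>"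
    by (auto simp: orthogonal_group_def)
qed (auto simp: orthogonal_group_def fun_eq_iff orthogonal_transformation_compose id_def
      orthogonal_transformation_id)

end

theory Submission
  imports Defs
begin

text \<open>
  For (ii), \<open>\<Phi> x \<circ> \<Phi> y = \<Phi> z\<close> for some \<open>z \<in> S\<close> because \<open>\<Phi> ` S\<close> is closed. Both \<open>\<Phi> z\<close> and
  \<open>\<Phi> (x \<circ> y)\<close> realize the injective map \<open>x \<circ> y\<close> on the points \<open>p v\<close>, so they differ by an element
  of \<open>framework_auts G p\<close>, and the coset hypothesis makes them equal.
\<close>

text \<open>The product of \<open>BijGroup\<close> is itself restricted to bijections of the vertex
  set, so it unfolds to \<open>compose\<close> only once both factors are known to be
  automorphisms.\<close>

lemma mult_graph_Aut:
  assumes "\<alpha> \<in> carrier (graph_Aut G)" "\<beta> \<in> carrier (graph_Aut G)"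
  shows "\<alpha> \<otimes>\<^bsub>graph_Aut G\<^esub> \<beta> = compose (pverts G) \<alpha> \<beta>"
  using assms by (simp add: graph_Aut_def graph_auts_def BijGroup_def)

lemma graph_Aut_mem_pverts:
  assumes "\<alpha> \<in> carrier (graph_Aut G)" "v \<in> pverts G"
  shows "\<alpha> v \<in> pverts G"
  using assms by (auto simp: graph_Aut_def graph_auts_def dest: Bij_imp_funcset)

text \<open>With \<beta> the quotient of \<gamma> by \<alpha> on the left, \<open>x (p v) = p
  (\<gamma> v) = p (\<alpha> (\<beta> v)) = x (p (\<beta> v))\<close>, and injectivity cancels
  \<open>x\<close>.\<close>

lemma mem_coset_framework_auts:
  assumes "\<alpha> \<in> carrier (graph_Aut G)" "\<gamma> \<in> carrier (graph_Aut G)"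
    and "inj x"
    and \<alpha>: "\<And>v. v \<in> pverts G \<Longrightarrow> x (p v) = p (\<alpha> v)"
    and \<gamma>: "\<And>v. v \<in> pverts G \<Longrightarrow> x (p v) = p (\<gamma> v)"
  shows "\<gamma> \<in> \<alpha> <#\<^bsub>graph_Aut G\<^esub> framework_auts G p"
proof -
  interpret group "graph_Aut G" by (rule group_graph_Aut)
  define \<beta> where "\<beta> = inv\<^bsub>graph_Aut G\<^esub> \<alpha> \<otimes>\<^bsub>graph_Aut G\<^esub> \<gamma>"
  have \<beta>: "\<beta> \<in> carrier (graph_Aut G)" and \<gamma>_eq: "\<alpha> \<otimes>\<^bsub>graph_Aut G\<^esub> \<beta> = \<gamma>"
    using assms(1,2) by (simp_all add: \<beta>_def flip: m_assoc)
  have "p v = p (\<beta> v)" if v: "v \<in> pverts G" for v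
  proof -
    have "\<gamma> v = \<alpha> (\<beta> v)"
      using \<gamma>_eq mult_graph_Aut[OF assms(1) \<beta>] v by (metis compose_eq)
    \<comment> \<open>The relation for \<alpha> is applied at \<open>\<beta> v\<close>, which is
      again a vertex.\<close>
    then have "x (p v) = x (p (\<beta> v))"
      using \<alpha>[OF graph_Aut_mem_pverts[OF \<beta> v]] \<gamma>[OF v] by simp
    then show ?thesis using \<open>inj x\<close> by (simp add: inj_eq)
  qed
  then have "\<beta> \<in> framework_auts G p" using \<beta> by (simp add: framework_auts_def)
  then show ?thesis unfolding l_coset_def using \<gamma>_eq by blast
qed

theorem theorem6p2:
  fixes S :: "(real ^ 'n \<Rightarrow> real ^ 'n) set"
    and G :: "'v pair_pre_digraph"
    and \<Phi> :: "(real ^ 'n \<Rightarrow> real ^ 'n) \<Rightarrow> ('v \<Rightarrow> 'v)"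
    and p :: "'v \<Rightarrow> real ^ 'n"
  assumes "symmetry_group S"
    and "simple_graph G"
    and "\<Phi> \<in> S \<rightarrow> carrier (graph_Aut G)"
    and "p \<in> realizations_of_type G S \<Phi>"
  shows "(\<Phi> \<in> hom (orthogonal_group \<lparr>carrier := S\<rparr>) (graph_Aut G)
            \<longrightarrow> subgroup (\<Phi> ` S) (graph_Aut G))
       \<and> (subgroup (\<Phi> ` S) (graph_Aut G)
            \<and> (\<forall>x \<in> S. \<forall>y \<in> S.
                 \<Phi> y \<in> \<Phi> x <#\<^bsub>graph_Aut G\<^esub> framework_auts G p \<longrightarrow> \<Phi> x = \<Phi> y)
            \<longrightarrow> \<Phi> \<in> hom (orthogonal_group \<lparr>carrier := S\<rparr>) (graph_Aut G))"
proof (intro conjI impI)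
  have S: "subgroup S orthogonal_group" using assms(1) by (simp add: symmetry_group_def)
  {
    assume hom: "\<Phi> \<in> hom (orthogonal_group \<lparr>carrier := S\<rparr>) (graph_Aut G)"
    \<comment> \<open>The image of a group under a homomorphism is a subgroup; the domain here is
      \<open>S\<close> as a group in its own right.\<close>
    have "group (orthogonal_group \<lparr>carrier := S\<rparr>)"
      by (rule subgroup.subgroup_is_group[OF S group_orthogonal_group])
    then have "group_hom (orthogonal_group \<lparr>carrier := S\<rparr>) (graph_Aut G) \<Phi>"
      using hom group_graph_Aut by (simp add: group_hom_def group_hom_axioms_def)
    from group_hom.img_is_subgroup[OF this]
    show "subgroup (\<Phi> ` S) (graph_Aut G)" by simp
  next
    assume H: "subgroup (\<Phi> ` S) (graph_Aut G)
      \<and> (\<forall>x \<in> S. \<forall>y \<in> S.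
           \<Phi> y \<in> \<Phi> x <#\<^bsub>graph_Aut G\<^esub> framework_auts G p \<longrightarrow> \<Phi> x = \<Phi> y)"
    have real: "x (p v) = p (\<Phi> x v)" if "x \<in> S" "v \<in> pverts G" for x v
      using assms(4) that by (simp add: realizations_of_type_def)
    have "\<Phi> (x \<circ> y) = \<Phi> x \<otimes>\<^bsub>graph_Aut G\<^esub> \<Phi> y" if x: "x \<in> S" and y: "y \<in> S" for x y
    proof -
      have xy: "x \<circ> y \<in> S"
        using subgroup.m_closed[OF S x y] by (simp add: orthogonal_group_def)
      then have "inj (x \<circ> y)"
        using subgroup.subset[OF S]
        by (auto simp: orthogonal_group_def intro!: orthogonal_transformation_inj)
      have aut: "\<Phi> x \<in> carrier (graph_Aut G)" "\<Phi> y \<in> carrier (graph_Aut G)"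
        "\<Phi> (x \<circ> y) \<in> carrier (graph_Aut G)"
        using assms(3) x y xy by auto
      \<comment> \<open>Closure only yields some \<open>z\<close> in \<open>S\<close>; it need not
        be \<open>x \<circ> y\<close>.\<close>
      obtain z where z: "z \<in> S" "\<Phi> x \<otimes>\<^bsub>graph_Aut G\<^esub> \<Phi> y = \<Phi> z"
        using subgroup.m_closed[OF conjunct1[OF H] imageI[OF x] imageI[OF y]] by blast
      have "\<Phi> z \<in> \<Phi> (x \<circ> y) <#\<^bsub>graph_Aut G\<^esub> framework_auts G p"
      proof (rule mem_coset_framework_auts[OF aut(3) _ \<open>inj (x \<circ> y)\<close>])
        show "\<Phi> z \<in> carrier (graph_Aut G)" using assms(3) z(1) by auto
        fix v assume v: "v \<in> pverts G"
        show "(x \<circ> y) (p v) = p (\<Phi> (x \<circ> y) v)" by (rule real[OF xy v])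
        \<comment> \<open>Moving \<open>y\<close> and then \<open>x\<close> inside \<open>p\<close>
          gives \<open>x (y (p v)) = x (p (\<Phi> y v)) = p (\<Phi> x (\<Phi> y v))\<close>.\<close>
        have "\<Phi> z v = \<Phi> x (\<Phi> y v)"
          using z(2) mult_graph_Aut[OF aut(1,2)] v by (metis compose_eq)
        then show "(x \<circ> y) (p v) = p (\<Phi> z v)"
          using real[OF y v] real[OF x graph_Aut_mem_pverts[OF aut(2) v]] by simp
      qed
      \<comment> \<open>The coset hypothesis for the pair \<open>x \<circ> y\<close>,
        \<open>z\<close> gives \<open>\<Phi> (x \<circ> y) = \<Phi> z\<close>, the required
        product.\<close>
      then show ?thesis using H xy z by metis
    qed
    then show "\<Phi> \<in> hom (orthogonal_group \<lparr>carrier := S\<rparr>) (graph_Aut G)"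
      using assms(3) by (auto simp: hom_def orthogonal_group_def)
  }
qed

end
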